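(* Let $R$ be a binomial ring and let $A$ be a binomial $\cup_1$-dga over $R$, with $Z^1(A)=\{a\in A^1: da=0\}$. Then for each $a\in Z^1(A)$ and each $k\ge0$, $$d\zeta_k(a)=-\sum_{\ell=1}^{k-1}\zeta_\ell(a)\cup\zeta_{k-\ell}(a).$$ More generally, if $I=(k_1,\dots,k_n)$ with integers $k_i\ge0$ and $\mathbf a=(a_1,\dots,a_n)$ with $a_i\in Z^1(A)$, then $$d(\zeta_I(\mathbf a))=-\sum_{\substack{I_1+I_2=I\\ I_j\ne\mathbf 0}}\zeta_{I_1}(\mathbf a)\cup\zeta_{I_2}(\mathbf a),$$ where the sum is over pairs of non-zero $n$-tuples of non-negative integers $I_1,I_2$ with $I_1+I_2=I$.
   Context: A binomial ring is a commutative unital ring $B$, torsion-free as a $\mathbb Z$-module, such that $\binom{b}{n}=b(b-1)\cdots(b-n+1)/n!\in B\otimes\mathbb Q$ lies in $B$ for all $b\in B$, $n>0$; write $\zeta_n(b)=\binom bn$ and $\zeta_0(b)=1$. Graded $R$-algebras $A=\bigoplus_{i\ge0}A^i$ are associative and unital, with injective structure map $R\to A$, so that $R\subset A^0$; the product is denoted $a\cup b$. A differential graded $R$-algebra (dga) is a graded $R$-algebra with an $R$-linear degree $1$ map $d$ with $d^2=0$ and $d(a\cup b)=da\cup b+(-1)^{|a|}a\cup db$ for homogeneous $a,b$. $D^2(A)\subseteq A^2$ is the $R$-submodule spanned by all $a\cup b$ with $a,b\in A^1$. A graded algebra with cup-one products is a graded $R$-algebra $A$ with $R$-linear maps $\cup_1\colon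 A^p\otimes_R A^1\to A^p$ for $p=1,2$ such that (i) $(a\cup b)\cup_1 c=a\cup(b\cup_1 c)+(a\cup_1 c)\cup b$ for all $a,b,c\in A^1$; (ii) the $R$-module $R\oplus A^1$, with multiplication $(r+a)(s+b)=rs+(rb+sa+a\cup_1 b)$, is a commutative ring. A $\cup_1$-dga is a differential graded $R$-algebra $(A,d)$ such that $A$ is a graded algebra with cup-one products, there is an $R$-linear map $\circ\colon D^2(A)\otimes_R D^2(A)\to D^2(A)$ with $(u\cup v)\circ(w\cup z)=(u\cup_1 w)\cup(v\cup_1 z)$ for all $u,v,w,z\in A^1$, and $d(a\cup_1 b)=-a\cup b-b\cup a+da\cup_1 b+db\cup_1 a-da\circ db$ for all $a,b\in A^1$ with $da,db\in D^2(A)$. A binomial $\cup_1$-dga over a binomial ring $R$ is a $\cup_1$-dga $(A,d)$ over $R$ such that the commutative ring $R\oplus A^1$ (with $\cup_1$ as multiplication on $A^1$) is a binomial ring. For $a\in A^1$ and $n\ge1$, $\zeta_n(a)=a\cup_1(a-1)\cup_1\cdots\cup_1(a-n+1)/n!\in A^1$, and $\zeta_0(a)=1\in R$. For $I=(i_1,\dots,i_n)$ and $\mathbf a=(a_1,\dots,a_n)$, $\zeta_I(\mathbf a)=\zeta_{i_1}(a_1)\cdots\zeta_{i_n}(a_n)$, the product being taken in the ring $R\oplus A^1$ (i.e. the cup-one product).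
   Formalization: The formal theorem additionally assumes that A^2 is torsion-free as a Z-module; without this the formula can fail (R = Z, A^1 = Ze, A^2 = Z/2 t, e cup_1 e = e, de = t, zero products, a = 2e, ζ_2(a) = e). *)

theory Defs
  imports "HOL-Algebra.Module" "HOL-Library.FuncSet" "HOL.Hull"
begin

section \<open>Binomial rings\<close>

definition torsion_free_on :: "('a, 'm) ring_scheme \<Rightarrow> 'a set \<Rightarrow> bool"
  where "torsion_free_on M S \<longleftrightarrow>
    (\<forall>n>0. \<forall>x\<in>S. [(n::nat)] \<cdot>\<^bsub>M\<^esub> x = \<zero>\<^bsub>M\<^esub> \<longrightarrow> x = \<zero>\<^bsub>M\<^esub>)"

definition falling_prod :: "('a, 'm) ring_scheme \<Rightarrow> nat \<Rightarrow> 'a \<Rightarrow> 'a"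
  where "falling_prod B n b = (\<Otimes>\<^bsub>B\<^esub>i\<in>{..<n}. b \<ominus>\<^bsub>B\<^esub> [i] \<cdot>\<^bsub>B\<^esub> \<one>\<^bsub>B\<^esub>)"

text \<open>
  As \<open>B\<close> is torsion-free, it embeds in its rationalization, and \<open>b(b-1)...(b-n+1)/n!\<close> lies
  in \<open>B\<close> iff the numerator is \<open>n!\<close> times an element of \<open>B\<close>. That element is then unique,
  and is selected by \<open>zeta\<close>.
\<close>

definition binomial_ring :: "('a, 'm) ring_scheme \<Rightarrow> bool"
  where "binomial_ring B \<longleftrightarrow> cring B \<and> torsion_free_on B (carrier B) \<and>
    (\<forall>b\<in>carrier B. \<forall>n>0. \<exists>c\<in>carrier B. [(fact n :: nat)] \<cdot>\<^bsub>B\<^esub> c = falling_prod B n b)"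

definition zeta :: "('a, 'm) ring_scheme \<Rightarrow> nat \<Rightarrow> 'a \<Rightarrow> 'a"
  where "zeta B n b = (THE c. c \<in> carrier B \<and> [(fact n :: nat)] \<cdot>\<^bsub>B\<^esub> c = falling_prod B n b)"


section \<open>Differential graded algebras\<close>

text \<open>
  The cup product is the multiplication of the ring \<open>A\<close>. Since \<open>A\<close> is an internal direct sum, the
  graded pieces \<open>G i\<close> are submodules of the carrier of \<open>A\<close>.
\<close>

locale graded_algebra = module R A + A?: ring A
  for R :: "('r, 'm) ring_scheme" (structure) and A :: "('r, 'a, 'n) module_scheme" (structure) +
  fixes G :: "nat \<Rightarrow> 'a set"
  assumes smult_mult_left:
      "\<lbrakk>r \<in> carrier R; x \<in> carrier A; y \<in> carrier A\<rbrakk> \<Longrightarrow>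
        (r \<odot>\<^bsub>A\<^esub> x) \<otimes>\<^bsub>A\<^esub> y = r \<odot>\<^bsub>A\<^esub> (x \<otimes>\<^bsub>A\<^esub> y)"
    and smult_mult_right:
      "\<lbrakk>r \<in> carrier R; x \<in> carrier A; y \<in> carrier A\<rbrakk> \<Longrightarrow>
        x \<otimes>\<^bsub>A\<^esub> (r \<odot>\<^bsub>A\<^esub> y) = r \<odot>\<^bsub>A\<^esub> (x \<otimes>\<^bsub>A\<^esub> y)"
    and submodule_grade: "submodule (G i) R A"
    and direct_sum:
      "x \<in> carrier A \<Longrightarrow>
        \<exists>!f. (\<forall>i. f i \<in> G i) \<and> finite {i. f i \<noteq> \<zero>\<^bsub>A\<^esub>} \<and>
             x = (\<Oplus>\<^bsub>A\<^esub>i\<in>{i. f i \<noteq> \<zero>\<^bsub>A\<^esub>}. f i)"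
    and grade_mult: "\<lbrakk>x \<in> G i; y \<in> G j\<rbrakk> \<Longrightarrow> x \<otimes>\<^bsub>A\<^esub> y \<in> G (i + j)"
    and structure_map_inj: "inj_on (\<lambda>r. r \<odot>\<^bsub>A\<^esub> \<one>\<^bsub>A\<^esub>) (carrier R)"
    and structure_map_grade: "r \<in> carrier R \<Longrightarrow> r \<odot>\<^bsub>A\<^esub> \<one>\<^bsub>A\<^esub> \<in> G 0"

locale dg_algebra = graded_algebra R A G
  for R :: "('r, 'm) ring_scheme" (structure) and A :: "('r, 'a, 'n) module_scheme" (structure)
    and G :: "nat \<Rightarrow> 'a set" +
  fixes d :: "'a \<Rightarrow> 'a"
  assumes diff_grade: "x \<in> G i \<Longrightarrow> d x \<in> G (i + 1)"
    and diff_add: "\<lbrakk>x \<in> carrier A; y \<in> carrier A\<rbrakk> \<Longrightarrow> d (x \<oplus>\<^bsub>A\<^esub> y) = d x \<oplus>\<^bsub>A\<^esub> d y"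
    and diff_smult: "\<lbrakk>r \<in> carrier R; x \<in> carrier A\<rbrakk> \<Longrightarrow> d (r \<odot>\<^bsub>A\<^esub> x) = r \<odot>\<^bsub>A\<^esub> d x"
    and diff_diff: "x \<in> carrier A \<Longrightarrow> d (d x) = \<zero>\<^bsub>A\<^esub>"
    and diff_mult:
      "\<lbrakk>x \<in> G i; y \<in> G j\<rbrakk> \<Longrightarrow>
        d (x \<otimes>\<^bsub>A\<^esub> y) = d x \<otimes>\<^bsub>A\<^esub> y \<oplus>\<^bsub>A\<^esub> ((\<ominus>\<^bsub>A\<^esub> \<one>\<^bsub>A\<^esub>) [^]\<^bsub>A\<^esub> i) \<otimes>\<^bsub>A\<^esub> (x \<otimes>\<^bsub>A\<^esub> d y)"

definition Z1 :: "('r, 'a, 'n) module_scheme \<Rightarrow> (nat \<Rightarrow> 'a set) \<Rightarrow> ('a \<Rightarrow> 'a) \<Rightarrow> 'a set"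
  where "Z1 A G d = {a \<in> G 1. d a = \<zero>\<^bsub>A\<^esub>}"

definition D2 :: "('r, 'm) ring_scheme \<Rightarrow> ('r, 'a, 'n) module_scheme \<Rightarrow> (nat \<Rightarrow> 'a set) \<Rightarrow> 'a set"
  where "D2 R A G = (\<lambda>S. submodule S R A) hull {a \<otimes>\<^bsub>A\<^esub> b | a b. a \<in> G 1 \<and> b \<in> G 1}"


section \<open>Cup-one products\<close>

text \<open>
  Bilinear maps \<open>X \<times> Y \<rightarrow> Z\<close> between submodules of \<open>A\<close> stand for linear maps on the tensor product
  of \<open>X\<close> and \<open>Y\<close> over \<open>R\<close>.
\<close>

definition bilinear_on ::
  "('r, 'm) ring_scheme \<Rightarrow> ('r, 'a, 'n) module_scheme \<Rightarrow> 'a set \<Rightarrow> 'a set \<Rightarrow> 'a set \<Rightarrow>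
    ('a \<Rightarrow> 'a \<Rightarrow> 'a) \<Rightarrow> bool"
  where "bilinear_on R A X Y Z f \<longleftrightarrow>
    (\<forall>x\<in>X. \<forall>y\<in>Y. f x y \<in> Z) \<and>
    (\<forall>x\<in>X. \<forall>x'\<in>X. \<forall>y\<in>Y. f (x \<oplus>\<^bsub>A\<^esub> x') y = f x y \<oplus>\<^bsub>A\<^esub> f x' y) \<and>
    (\<forall>x\<in>X. \<forall>y\<in>Y. \<forall>y'\<in>Y. f x (y \<oplus>\<^bsub>A\<^esub> y') = f x y \<oplus>\<^bsub>A\<^esub> f x y') \<and>
    (\<forall>r\<in>carrier R. \<forall>x\<in>X. \<forall>y\<in>Y. f (r \<odot>\<^bsub>A\<^esub> x) y = r \<odot>\<^bsub>A\<^esub> f x y) \<and>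
    (\<forall>r\<in>carrier R. \<forall>x\<in>X. \<forall>y\<in>Y. f x (r \<odot>\<^bsub>A\<^esub> y) = r \<odot>\<^bsub>A\<^esub> f x y)"

text \<open>The external direct sum of \<open>R\<close> and \<open>G 1\<close> with product \<open>(r+a)(s+b) = rs + (rb + sa + cup1 a b)\<close>.\<close>

definition cup_one_ring ::
  "('r, 'm) ring_scheme \<Rightarrow> ('r, 'a, 'n) module_scheme \<Rightarrow> (nat \<Rightarrow> 'a set) \<Rightarrow> ('a \<Rightarrow> 'a \<Rightarrow> 'a) \<Rightarrow>
    ('r \<times> 'a) ring"
  where "cup_one_ring R A G cup1 =
    \<lparr>carrier = carrier R \<times> G 1,
     mult = (\<lambda>(r, a) (s, b). (r \<otimes>\<^bsub>R\<^esub> s, r \<odot>\<^bsub>A\<^esub> b \<oplus>\<^bsub>A\<^esub> s \<odot>\<^bsub>A\<^esub> a \<oplus>\<^bsub>A\<^esub> cup1 a b)),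
     one = (\<one>\<^bsub>R\<^esub>, \<zero>\<^bsub>A\<^esub>),
     zero = (\<zero>\<^bsub>R\<^esub>, \<zero>\<^bsub>A\<^esub>),
     add = (\<lambda>(r, a) (s, b). (r \<oplus>\<^bsub>R\<^esub> s, a \<oplus>\<^bsub>A\<^esub> b))\<rparr>"

text \<open>
  One function \<open>cup1\<close> serves for both \<open>p = 1\<close> and \<open>p = 2\<close>: \<open>G 1\<close> and \<open>G 2\<close> meet only in zero,
  where bilinearity forces both maps to vanish.
\<close>

locale cup_one_algebra = graded_algebra R A G
  for R :: "('r, 'm) ring_scheme" (structure) and A :: "('r, 'a, 'n) module_scheme" (structure)
    and G :: "nat \<Rightarrow> 'a set" +
  fixes cup1 :: "'a \<Rightarrow> 'a \<Rightarrow> 'a"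
  assumes cup1_bilinear: "p \<in> {1, 2} \<Longrightarrow> bilinear_on R A (G p) (G 1) (G p) cup1"
    and cup1_Hirsch:
      "\<lbrakk>a \<in> G 1; b \<in> G 1; c \<in> G 1\<rbrakk> \<Longrightarrow>
        cup1 (a \<otimes>\<^bsub>A\<^esub> b) c = a \<otimes>\<^bsub>A\<^esub> cup1 b c \<oplus>\<^bsub>A\<^esub> cup1 a c \<otimes>\<^bsub>A\<^esub> b"
    and cup_one_ring_cring: "cring (cup_one_ring R A G cup1)"

locale cup_one_dga = dg_algebra R A G d + cup_one_algebra R A G cup1
  for R :: "('r, 'm) ring_scheme" (structure) and A :: "('r, 'a, 'n) module_scheme" (structure)
    and G :: "nat \<Rightarrow> 'a set" and d :: "'a \<Rightarrow> 'a" and cup1 :: "'a \<Rightarrow> 'a \<Rightarrow> 'a" +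
  fixes circ :: "'a \<Rightarrow> 'a \<Rightarrow> 'a"
  assumes circ_bilinear: "bilinear_on R A (D2 R A G) (D2 R A G) (D2 R A G) circ"
    and circ_mult:
      "\<lbrakk>u \<in> G 1; v \<in> G 1; w \<in> G 1; z \<in> G 1\<rbrakk> \<Longrightarrow>
        circ (u \<otimes>\<^bsub>A\<^esub> v) (w \<otimes>\<^bsub>A\<^esub> z) = cup1 u w \<otimes>\<^bsub>A\<^esub> cup1 v z"
    and diff_cup1:
      "\<lbrakk>a \<in> G 1; b \<in> G 1; d a \<in> D2 R A G; d b \<in> D2 R A G\<rbrakk> \<Longrightarrow>
        d (cup1 a b) =
          \<ominus>\<^bsub>A\<^esub> (a \<otimes>\<^bsub>A\<^esub> b) \<ominus>\<^bsub>A\<^esub> b \<otimes>\<^bsub>A\<^esub> a \<oplus>\<^bsub>A\<^esub> cup1 (d a) b \<oplus>\<^bsub>A\<^esub> cup1 (d b) a \<ominus>\<^bsub>A\<^esub> circ (d a) (d b)"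

locale binomial_cup_one_dga = cup_one_dga R A G d cup1 circ
  for R :: "('r, 'm) ring_scheme" (structure) and A :: "('r, 'a, 'n) module_scheme" (structure)
    and G :: "nat \<Rightarrow> 'a set" and d :: "'a \<Rightarrow> 'a" and cup1 circ :: "'a \<Rightarrow> 'a \<Rightarrow> 'a" +
  assumes base_binomial: "binomial_ring R"
    and cup_one_ring_binomial: "binomial_ring (cup_one_ring R A G cup1)"


text \<open>
  A binomial cup-one dga may have torsion in degree two, and the formula for \<open>d (zeta_k a)\<close> can then
  fail, which is why the theorem also assumes \<open>torsion_free_on A (G 2)\<close>. Take \<open>R\<close> the integers,
  \<open>G 1\<close> infinite cyclic on \<open>e\<close> with \<open>cup1 e e = e\<close>, \<open>G 2\<close> of order two on \<open>t\<close>, all products of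
  positive-degree elements zero, and \<open>d e = t\<close>. Then \<open>a = 2e\<close> is a cocycle and \<open>zeta_2 a = e\<close>, so
  \<open>d (zeta_2 a) = t\<close>, whereas \<open>- a \<union> a = 0\<close>.
\<close>


section \<open>Zeta maps on tuples\<close>

text \<open>The inclusion of \<open>R \<oplus> G 1\<close> in \<open>A\<close>, with \<open>R\<close> contained in \<open>G 0\<close> through the structure map.\<close>

definition cup_one_incl :: "('r, 'a, 'n) module_scheme \<Rightarrow> 'r \<times> 'a \<Rightarrow> 'a"
  where "cup_one_incl A = (\<lambda>(r, a). r \<odot>\<^bsub>A\<^esub> \<one>\<^bsub>A\<^esub> \<oplus>\<^bsub>A\<^esub> a)"

definition zeta1 ::
  "('r, 'm) ring_scheme \<Rightarrow> ('r, 'a, 'n) module_scheme \<Rightarrow> (nat \<Rightarrow> 'a set) \<Rightarrow> ('a \<Rightarrow> 'a \<Rightarrow> 'a) \<Rightarrow>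
    nat \<Rightarrow> 'a \<Rightarrow> 'a"
  where "zeta1 R A G cup1 k a = cup_one_incl A (zeta (cup_one_ring R A G cup1) k (\<zero>\<^bsub>R\<^esub>, a))"

text \<open>\<open>n\<close>-tuples are functions on \<open>nat\<close>, of which only the values on \<open>{..<n}\<close> matter.\<close>

definition zeta_tuple ::
  "('r, 'm) ring_scheme \<Rightarrow> ('r, 'a, 'n) module_scheme \<Rightarrow> (nat \<Rightarrow> 'a set) \<Rightarrow> ('a \<Rightarrow> 'a \<Rightarrow> 'a) \<Rightarrow>
    nat \<Rightarrow> (nat \<Rightarrow> nat) \<Rightarrow> (nat \<Rightarrow> 'a) \<Rightarrow> 'a"
  where "zeta_tuple R A G cup1 n I a =
    cup_one_incl A (\<Otimes>\<^bsub>cup_one_ring R A G cup1\<^esub>i\<in>{..<n}.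
      zeta (cup_one_ring R A G cup1) (I i) (\<zero>\<^bsub>R\<^esub>, a i))"

definition nonzero_splittings :: "nat \<Rightarrow> (nat \<Rightarrow> nat) \<Rightarrow> ((nat \<Rightarrow> nat) \<times> (nat \<Rightarrow> nat)) set"
  where "nonzero_splittings n I =
    {(J, K). J \<in> {..<n} \<rightarrow>\<^sub>E UNIV \<and> K \<in> {..<n} \<rightarrow>\<^sub>E UNIV \<and> (\<forall>i<n. J i + K i = I i) \<and>
             (\<exists>i<n. J i \<noteq> 0) \<and> (\<exists>i<n. K i \<noteq> 0)}"

end

theory Submission
  imports Defs
begin

text \<open>
  Write \<open>b\<^sub>i = (0, a\<^sub>i)\<close> for the cocycle \<open>a\<^sub>i\<close> in the ring \<open>R \<oplus> G 1\<close>, \<open>P\<^sub>J\<close> for the product of the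
  \<open>\<zeta>\<^bsub>J i\<^esub>(b\<^sub>i)\<close> in that ring, and \<open>\<epsilon>\<^sub>J\<close>, \<open>z\<^sub>J\<close> for its components in \<open>R\<close> and \<open>G 1\<close>. As \<open>R\<close> is torsion-free,
  \<open>\<epsilon>\<^sub>J\<close> is \<open>1\<close> for \<open>J = 0\<close> and \<open>0\<close> otherwise, and \<open>z\<^sub>0 = 0\<close>. So the claim is \<open>d z\<^sub>I = - T\<^sub>I\<close>, where
  \<open>T\<^sub>I\<close> is the sum of \<open>z\<^sub>J \<union> z\<^sub>K\<close> over all splittings \<open>J + K = I\<close>, the trivial ones
  contributing nothing.

  The recurrence \<open>\<zeta>\<^sub>k(b) b = (k + 1) \<zeta>\<^bsub>k+1\<^esub>(b) + k \<zeta>\<^sub>k(b)\<close> yields, with \<open>e\<^sub>j\<close> the \<open>j\<close>-th unit tuple,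
  \<open>\<epsilon>\<^sub>J a\<^sub>j + (z\<^sub>J \<union>\<^sub>1 a\<^sub>j) = (J\<^sub>j + 1) z\<^bsub>J+e\<^esub> + J\<^sub>j z\<^sub>J\<close> (lemma \<open>zeta_part_mult\<close>; \<open>e\<close> is \<open>e\<^sub>j\<close>). Applying
  the Hirsch identity to each summand of \<open>T\<^sub>I \<union>\<^sub>1 a\<^sub>j\<close>, then this recurrence to both factors, and
  shifting the summation index gives
  \<open>T\<^sub>I \<union>\<^sub>1 a\<^sub>j + z\<^sub>I \<union> a\<^sub>j + a\<^sub>j \<union> z\<^sub>I = I\<^sub>j T\<^sub>I + (I\<^sub>j + 1) T\<^bsub>I+e\<^esub>\<close> (lemma \<open>coproduct_cup1\<close>).

  The claim follows by induction on the sum of the entries of \<open>I\<close>. Suppose \<open>d z\<^sub>I = - T\<^sub>I\<close>. Then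
  \<open>d z\<^sub>I\<close> lies in the span of the products of degree-one elements, and \<open>d a\<^sub>j = 0\<close>, so the formula for
  \<open>d (z\<^sub>I \<union>\<^sub>1 a\<^sub>j)\<close> reads \<open>- z\<^sub>I \<union> a\<^sub>j - a\<^sub>j \<union> z\<^sub>I - T\<^sub>I \<union>\<^sub>1 a\<^sub>j\<close>. Comparing this with the two identities
  leaves \<open>(I\<^sub>j + 1) d z\<^bsub>I+e\<^esub> = - (I\<^sub>j + 1) T\<^bsub>I+e\<^esub>\<close>, and \<open>G 2\<close> is torsion-free. The formula for a single
  cocycle is the case of tuples of length one.
\<close>

section \<open>The zeta maps of a binomial ring\<close>

text \<open>The predicate \<open>binomial_ring\<close> as an extension of the locale of commutative rings.\<close>

locale binomial_cring = cring B for B (structure) +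
  assumes binomial: "binomial_ring B"
begin

lemma torsion_free:
  assumes "(n::nat) > 0" "x \<in> carrier B" "[n] \<cdot> x = \<zero>"
  shows "x = \<zero>"
  using binomial assms unfolding binomial_ring_def torsion_free_on_def by blast

lemma nat_mult_cancel:
  assumes "(n::nat) > 0" "x \<in> carrier B" "y \<in> carrier B" "[n] \<cdot> x = [n] \<cdot> y"
  shows "x = y"
proof -
  have "[n] \<cdot> (x \<ominus> y) = [n] \<cdot> x \<ominus> [n] \<cdot> y"
    using assms(2,3) by (simp add: a_minus_def add.pow_mult_distrib add.m_comm add.nat_pow_inv)
  also have "\<dots> = \<zero>" using assms by (simp add: a_minus_def r_neg)
  finally have "x \<ominus> y = \<zero>" using torsion_free assms by blast
  then show ?thesis using assms(2,3) minus_equality[of x "\<ominus> y"] by (simp add: a_minus_def)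
qed

lemma falling_prod_closed: "b \<in> carrier B \<Longrightarrow> falling_prod B n b \<in> carrier B"
  unfolding falling_prod_def by (intro finprod_closed) auto

lemma falling_prod_0: "falling_prod B 0 b = \<one>"
  by (simp add: falling_prod_def)

lemma falling_prod_Suc:
  assumes "b \<in> carrier B"
  shows "falling_prod B (Suc n) b = falling_prod B n b \<otimes> (b \<ominus> [n] \<cdot> \<one>)"
proof -
  have "falling_prod B (Suc n) b = (b \<ominus> [n] \<cdot> \<one>) \<otimes> falling_prod B n b"
    using assms unfolding falling_prod_def lessThan_Suc by (subst finprod_insert) auto
  then show ?thesis using assms falling_prod_closed by (simp add: m_comm)
qed

lemma zeta_ex1:
  assumes "b \<in> carrier B"
  shows "\<exists>!c. c \<in> carrier B \<and> [(fact n :: nat)] \<cdot> c = falling_prod B n b"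
proof -
  have "\<exists>c\<in>carrier B. [(fact n :: nat)] \<cdot> c = falling_prod B n b"
  proof (cases "n = 0")
    case True
    then show ?thesis by (intro bexI[of _ \<one>]) (simp_all add: falling_prod_0)
  next
    case False
    then show ?thesis using binomial assms unfolding binomial_ring_def by auto
  qed
  moreover have "c = c'" if "c \<in> carrier B" "c' \<in> carrier B"
    "[(fact n :: nat)] \<cdot> c = [(fact n :: nat)] \<cdot> c'" for c c'
    using nat_mult_cancel[OF fact_gt_zero that] .
  ultimately show ?thesis by (intro ex_ex1I) auto
qed

lemma zeta_closed: "b \<in> carrier B \<Longrightarrow> zeta B n b \<in> carrier B"
  and fact_mult_zeta: "b \<in> carrier B \<Longrightarrow> [(fact n :: nat)] \<cdot> zeta B n b = falling_prod B n b"
  using theI'[OF zeta_ex1, of b n] unfolding zeta_def by auto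

lemma zeta_0:
  assumes "b \<in> carrier B"
  shows "zeta B 0 b = \<one>"
  using fact_mult_zeta[OF assms, of 0] zeta_closed[OF assms, of 0] by (simp add: falling_prod_0)

text \<open>
  The identity \<open>(k + 1) \<zeta>\<^bsub>k+1\<^esub>(b) = \<zeta>\<^sub>k(b) (b - k)\<close>, rearranged so that it needs no subtraction.
\<close>

lemma zeta_mult:
  assumes b: "b \<in> carrier B"
  shows "zeta B k b \<otimes> b = [Suc k] \<cdot> zeta B (Suc k) b \<oplus> [k] \<cdot> zeta B k b"
proof -
  note cl = zeta_closed[OF b]
  have "[(fact k :: nat)] \<cdot> ([Suc k] \<cdot> zeta B (Suc k) b) = [(fact (Suc k) :: nat)] \<cdot> zeta B (Suc k) b"
    using add.nat_pow_pow[OF cl, of "fact k" "Suc k"] by (simp only: fact_Suc of_nat_id)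
  also have "\<dots> = falling_prod B k b \<otimes> (b \<ominus> [k] \<cdot> \<one>)"
    by (simp only: fact_mult_zeta[OF b] falling_prod_Suc[OF b])
  also have "\<dots> = [(fact k :: nat)] \<cdot> (zeta B k b \<otimes> (b \<ominus> [k] \<cdot> \<one>))"
    using cl b by (simp add: fact_mult_zeta[OF b, symmetric] add_pow_ldistr)
  finally have "[Suc k] \<cdot> zeta B (Suc k) b = zeta B k b \<otimes> (b \<ominus> [k] \<cdot> \<one>)"
    using cl b nat_mult_cancel[OF fact_gt_zero[of k], of "[Suc k] \<cdot> zeta B (Suc k) b"]
    by (simp del: add.nat_pow_Suc)
  also have "\<dots> = zeta B k b \<otimes> b \<ominus> [k] \<cdot> zeta B k b"
    using cl b by (simp add: a_minus_def r_distr r_minus add_pow_rdistr)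
  finally show ?thesis
    using cl b by (simp add: a_minus_def add.m_assoc l_neg)
qed

text \<open>
  Multiplying a product of zeta values by one of the arguments affects the factor at that index only.
\<close>

lemma zeta_finprod_mult:
  assumes "finite S" "j \<in> S" "\<And>i. i \<in> S \<Longrightarrow> b i \<in> carrier B"
  shows "(\<Otimes>i\<in>S. zeta B (J i) (b i)) \<otimes> b j =
    [Suc (J j)] \<cdot> (\<Otimes>i\<in>S. zeta B ((J(j := Suc (J j))) i) (b i)) \<oplus> [J j] \<cdot> (\<Otimes>i\<in>S. zeta B (J i) (b i))"
proof -
  let ?Q = "\<Otimes>i\<in>S - {j}. zeta B (J i) (b i)"
  have Q: "?Q \<in> carrier B" and bj: "b j \<in> carrier B"
    using assms by (auto intro!: finprod_closed zeta_closed)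
  have split: "(\<Otimes>i\<in>S. zeta B (K i) (b i)) =
      zeta B (K j) (b j) \<otimes> (\<Otimes>i\<in>S - {j}. zeta B (K i) (b i))" for K
    using assms finprod_insert[of "S - {j}" j "\<lambda>i. zeta B (K i) (b i)"]
    by (auto simp: insert_absorb zeta_closed Pi_def)
  have "(\<Otimes>i\<in>S - {j}. zeta B ((J(j := Suc (J j))) i) (b i)) = ?Q"
    using assms by (intro finprod_cong') (auto simp: zeta_closed)
  then have S: "(\<Otimes>i\<in>S. zeta B ((J(j := Suc (J j))) i) (b i)) = zeta B (Suc (J j)) (b j) \<otimes> ?Q"
    using split[of "J(j := Suc (J j))"] by simp
  have "zeta B (J j) (b j) \<otimes> ?Q \<otimes> b j = (zeta B (J j) (b j) \<otimes> b j) \<otimes> ?Q"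
    using Q bj zeta_closed[OF bj] by (simp add: m_ac)
  also have "\<dots> = [Suc (J j)] \<cdot> (zeta B (Suc (J j)) (b j) \<otimes> ?Q) \<oplus> [J j] \<cdot> (zeta B (J j) (b j) \<otimes> ?Q)"
    unfolding zeta_mult[OF bj] using Q bj zeta_closed[OF bj]
    by (simp add: l_distr add_pow_ldistr del: add.nat_pow_Suc)
  finally show ?thesis unfolding S split[of J] .
qed

end

section \<open>Graded pieces, differentials and cup-one products\<close>

lemma (in abelian_group) add_idem_zero:
  assumes "x \<in> carrier G" "x = x \<oplus> x"
  shows "x = \<zero>"
  using add.l_cancel_one'[OF assms(1) assms(1)] assms(2) by blast

lemma (in abelian_group) finsum_nat_mult:
  assumes "f \<in> S \<rightarrow> carrier G"
  shows "(\<Oplus>s\<in>S. [(k::nat)] \<cdot> f s) = [k] \<cdot> (\<Oplus>s\<in>S. f s)"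
  using assms by (induction k) (simp_all add: finsum_addf Pi_def)

context graded_algebra
begin

lemma grade_carrier: "x \<in> G i \<Longrightarrow> x \<in> carrier A"
  using subgroup.subset[OF submodule.axioms(1)[OF submodule_grade]] by auto

lemma submodule_ops:
  assumes "submodule S R A"
  shows "\<zero>\<^bsub>A\<^esub> \<in> S"
    and "x \<in> S \<Longrightarrow> y \<in> S \<Longrightarrow> x \<oplus>\<^bsub>A\<^esub> y \<in> S"
    and "x \<in> S \<Longrightarrow> \<ominus>\<^bsub>A\<^esub> x \<in> S"
proof -
  interpret S: subgroup S "add_monoid A" using assms by (rule submodule.axioms(1))
  show "\<zero>\<^bsub>A\<^esub> \<in> S" using S.one_closed by simp
  show "x \<in> S \<Longrightarrow> y \<in> S \<Longrightarrow> x \<oplus>\<^bsub>A\<^esub> y \<in> S" using S.m_closed[of x y] by simp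
  show "x \<in> S \<Longrightarrow> \<ominus>\<^bsub>A\<^esub> x \<in> S" using S.m_inv_closed[of x] unfolding a_inv_def by simp
qed

lemma grade_zero: "\<zero>\<^bsub>A\<^esub> \<in> G i"
  and grade_add: "x \<in> G i \<Longrightarrow> y \<in> G i \<Longrightarrow> x \<oplus>\<^bsub>A\<^esub> y \<in> G i"
  and grade_minus: "x \<in> G i \<Longrightarrow> \<ominus>\<^bsub>A\<^esub> x \<in> G i"
  using submodule_ops[OF submodule_grade] by blast+

lemma grade_finsum:
  assumes "\<And>s. s \<in> S \<Longrightarrow> f s \<in> G i"
  shows "(\<Oplus>\<^bsub>A\<^esub>s\<in>S. f s) \<in> G i"
  using assms
proof (induction S rule: infinite_finite_induct)
  case (insert x F)
  then show ?case by (subst M.finsum_insert) (auto intro: grade_add grade_carrier)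
qed (auto simp: grade_zero)

lemma D2_mult: "x \<in> G 1 \<Longrightarrow> y \<in> G 1 \<Longrightarrow> x \<otimes>\<^bsub>A\<^esub> y \<in> D2 R A G"
  unfolding D2_def by (rule hull_inc) auto

lemma D2_zero: "\<zero>\<^bsub>A\<^esub> \<in> D2 R A G"
  unfolding D2_def hull_def using submodule_ops(1) by blast

lemma D2_add: "x \<in> D2 R A G \<Longrightarrow> y \<in> D2 R A G \<Longrightarrow> x \<oplus>\<^bsub>A\<^esub> y \<in> D2 R A G"
  unfolding D2_def hull_def using submodule_ops(2) by blast

lemma D2_minus: "x \<in> D2 R A G \<Longrightarrow> \<ominus>\<^bsub>A\<^esub> x \<in> D2 R A G"
  unfolding D2_def hull_def using submodule_ops(3) by blast

lemma D2_grade: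
  assumes "x \<in> D2 R A G"
  shows "x \<in> G 2"
proof -
  have "{a \<otimes>\<^bsub>A\<^esub> b | a b. a \<in> G 1 \<and> b \<in> G 1} \<subseteq> G 2"
    using grade_mult[of _ 1 _ 1] by (auto simp: numeral_2_eq_2)
  from subsetD[OF hull_minimal[of _ _ "\<lambda>S. submodule S R A", OF this submodule_grade]] assms
  show ?thesis unfolding D2_def .
qed

lemma D2_finsum:
  assumes "\<And>s. s \<in> S \<Longrightarrow> f s \<in> D2 R A G"
  shows "(\<Oplus>\<^bsub>A\<^esub>s\<in>S. f s) \<in> D2 R A G"
  using assms
proof (induction S rule: infinite_finite_induct)
  case (insert x F)
  then show ?case
    by (subst M.finsum_insert) (auto intro: D2_add grade_carrier[OF D2_grade])
qed (auto simp: D2_zero)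

end

context dg_algebra
begin

lemma diff_zero: "d \<zero>\<^bsub>A\<^esub> = \<zero>\<^bsub>A\<^esub>"
proof (rule M.add_idem_zero)
  show "d \<zero>\<^bsub>A\<^esub> \<in> carrier A" by (rule grade_carrier[OF diff_grade[OF grade_zero]])
  show "d \<zero>\<^bsub>A\<^esub> = d \<zero>\<^bsub>A\<^esub> \<oplus>\<^bsub>A\<^esub> d \<zero>\<^bsub>A\<^esub>" using diff_add[of "\<zero>\<^bsub>A\<^esub>" "\<zero>\<^bsub>A\<^esub>"] by simp
qed

lemma diff_nat_mult:
  assumes "x \<in> G i"
  shows "d ([(k::nat)] \<cdot>\<^bsub>A\<^esub> x) = [k] \<cdot>\<^bsub>A\<^esub> d x"
  using grade_carrier[OF assms] by (induction k) (simp_all add: diff_zero diff_add)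

lemma one_grade: "\<one>\<^bsub>A\<^esub> \<in> G 0"
  using structure_map_grade[of "\<one>\<^bsub>R\<^esub>"] by simp

lemma diff_one: "d \<one>\<^bsub>A\<^esub> = \<zero>\<^bsub>A\<^esub>"
proof -
  have "d \<one>\<^bsub>A\<^esub> \<in> carrier A" using diff_grade[OF one_grade] grade_carrier by blast
  then show ?thesis
    using M.add_idem_zero[of "d \<one>\<^bsub>A\<^esub>"] diff_mult[OF one_grade one_grade] by simp
qed

lemma diff_cup_one_incl:
  assumes x: "r \<in> carrier R" "b \<in> G i"
  shows "d (cup_one_incl A (r, b)) = d b"
proof -
  have "d b \<in> carrier A" using diff_grade[OF x(2)] grade_carrier by blast
  then show ?thesis using x grade_carrier[OF x(2)]
    by (simp add: cup_one_incl_def diff_add diff_smult diff_one)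
qed

end

context cup_one_algebra
begin

lemma cup1_closed: "p \<in> {1, 2::nat} \<Longrightarrow> x \<in> G p \<Longrightarrow> b \<in> G 1 \<Longrightarrow> cup1 x b \<in> G p"
  and cup1_add: "p \<in> {1, 2::nat} \<Longrightarrow> x \<in> G p \<Longrightarrow> y \<in> G p \<Longrightarrow> b \<in> G 1 \<Longrightarrow>
    cup1 (x \<oplus>\<^bsub>A\<^esub> y) b = cup1 x b \<oplus>\<^bsub>A\<^esub> cup1 y b"
  using cup1_bilinear[of p] unfolding bilinear_on_def by blast+

lemma cup1_zero:
  assumes p: "p \<in> {1, 2::nat}" and b: "b \<in> G 1"
  shows "cup1 \<zero>\<^bsub>A\<^esub> b = \<zero>\<^bsub>A\<^esub>"
proof (rule M.add_idem_zero)
  show "cup1 \<zero>\<^bsub>A\<^esub> b \<in> carrier A"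
    by (rule grade_carrier[OF cup1_closed[OF p grade_zero b]])
  show "cup1 \<zero>\<^bsub>A\<^esub> b = cup1 \<zero>\<^bsub>A\<^esub> b \<oplus>\<^bsub>A\<^esub> cup1 \<zero>\<^bsub>A\<^esub> b"
    using cup1_add[OF p grade_zero grade_zero b] by simp
qed

lemma cup1_minus:
  assumes "p \<in> {1, 2::nat}" "x \<in> G p" "b \<in> G 1"
  shows "cup1 (\<ominus>\<^bsub>A\<^esub> x) b = \<ominus>\<^bsub>A\<^esub> cup1 x b"
proof -
  have "cup1 (\<ominus>\<^bsub>A\<^esub> x) b \<oplus>\<^bsub>A\<^esub> cup1 x b = cup1 (\<ominus>\<^bsub>A\<^esub> x \<oplus>\<^bsub>A\<^esub> x) b"
    using assms by (simp add: cup1_add grade_minus)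
  also have "\<dots> = \<zero>\<^bsub>A\<^esub>" using assms cup1_zero grade_carrier by (simp add: M.l_neg)
  finally have "\<ominus>\<^bsub>A\<^esub> cup1 x b = cup1 (\<ominus>\<^bsub>A\<^esub> x) b"
    by (rule M.minus_equality) (use assms cup1_closed grade_minus grade_carrier in blast)+
  then show ?thesis ..
qed

lemma cup1_finsum:
  assumes "p \<in> {1, 2::nat}" "b \<in> G 1" "\<And>s. s \<in> S \<Longrightarrow> f s \<in> G p"
  shows "cup1 (\<Oplus>\<^bsub>A\<^esub>s\<in>S. f s) b = (\<Oplus>\<^bsub>A\<^esub>s\<in>S. cup1 (f s) b)"
  using assms(3)
proof (induction S rule: infinite_finite_induct)
  case (insert x F)
  have "f \<in> F \<rightarrow> carrier A" "(\<lambda>s. cup1 (f s) b) \<in> F \<rightarrow> carrier A"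
    "f x \<in> carrier A" "cup1 (f x) b \<in> carrier A"
    using insert.prems grade_carrier cup1_closed[OF assms(1) _ assms(2)] by blast+
  moreover have "(\<Oplus>\<^bsub>A\<^esub>s\<in>F. f s) \<in> G p" using insert.prems by (intro grade_finsum) auto
  ultimately show ?case using insert assms(1,2) by (simp add: M.finsum_insert cup1_add)
qed (use assms cup1_zero in auto)

end

context cup_one_dga
begin

lemma circ_zero_right:
  assumes "x \<in> D2 R A G"
  shows "circ x \<zero>\<^bsub>A\<^esub> = \<zero>\<^bsub>A\<^esub>"
proof (rule M.add_idem_zero)
  have "circ x \<zero>\<^bsub>A\<^esub> \<in> D2 R A G"
    using circ_bilinear assms D2_zero unfolding bilinear_on_def by blast
  then show "circ x \<zero>\<^bsub>A\<^esub> \<in> carrier A"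
    by (rule grade_carrier[OF D2_grade])
  have "circ x (\<zero>\<^bsub>A\<^esub> \<oplus>\<^bsub>A\<^esub> \<zero>\<^bsub>A\<^esub>) = circ x \<zero>\<^bsub>A\<^esub> \<oplus>\<^bsub>A\<^esub> circ x \<zero>\<^bsub>A\<^esub>"
    using circ_bilinear assms D2_zero unfolding bilinear_on_def by blast
  then show "circ x \<zero>\<^bsub>A\<^esub> = circ x \<zero>\<^bsub>A\<^esub> \<oplus>\<^bsub>A\<^esub> circ x \<zero>\<^bsub>A\<^esub>" by simp
qed

end

section \<open>The components of a product of zeta values\<close>

context binomial_cup_one_dga
begin

text \<open>The external direct sum of \<open>R\<close> and \<open>G 1\<close>, with the cup-one product.\<close>

abbreviation C where "C \<equiv> cup_one_ring R A G cup1"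

interpretation B: binomial_cring R
  using base_binomial
  by (auto simp: binomial_cring_def binomial_cring_axioms_def binomial_ring_def)

interpretation C: binomial_cring C
  using cup_one_ring_binomial cup_one_ring_cring
  by (auto simp: binomial_cring_def binomial_cring_axioms_def)

lemma C_simps:
  "carrier C = carrier R \<times> G 1"
  "\<one>\<^bsub>C\<^esub> = (\<one>\<^bsub>R\<^esub>, \<zero>\<^bsub>A\<^esub>)"
  "\<zero>\<^bsub>C\<^esub> = (\<zero>\<^bsub>R\<^esub>, \<zero>\<^bsub>A\<^esub>)"
  "fst (x \<oplus>\<^bsub>C\<^esub> y) = fst x \<oplus>\<^bsub>R\<^esub> fst y"
  "snd (x \<oplus>\<^bsub>C\<^esub> y) = snd x \<oplus>\<^bsub>A\<^esub> snd y"
  "fst (x \<otimes>\<^bsub>C\<^esub> y) = fst x \<otimes>\<^bsub>R\<^esub> fst y"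
  "snd (x \<otimes>\<^bsub>C\<^esub> y) = fst x \<odot>\<^bsub>A\<^esub> snd y \<oplus>\<^bsub>A\<^esub> fst y \<odot>\<^bsub>A\<^esub> snd x \<oplus>\<^bsub>A\<^esub> cup1 (snd x) (snd y)"
  by (auto simp: cup_one_ring_def split: prod.splits)

lemma C_nat_mult:
  "fst ([(k::nat)] \<cdot>\<^bsub>C\<^esub> x) = [k] \<cdot>\<^bsub>R\<^esub> fst x"
  "snd ([(k::nat)] \<cdot>\<^bsub>C\<^esub> x) = [k] \<cdot>\<^bsub>A\<^esub> snd x"
  by (induction k) (simp_all add: C_simps)

text \<open>
  If \<open>\<epsilon>\<^sub>k\<close> is the component of \<open>\<zeta>\<^sub>k(0, b)\<close> in \<open>R\<close>, then the recurrence \<open>zeta_mult\<close> gives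
  \<open>(k + 1) \<epsilon>\<^bsub>k+1\<^esub> + k \<epsilon>\<^sub>k = 0\<close>. This determines all \<open>\<epsilon>\<^sub>k\<close> with \<open>k > 0\<close>, as \<open>R\<close> is torsion-free.
\<close>

lemma fst_zeta:
  assumes "b \<in> G 1"
  shows "fst (zeta C k (\<zero>\<^bsub>R\<^esub>, b)) = (if k = 0 then \<one>\<^bsub>R\<^esub> else \<zero>\<^bsub>R\<^esub>)"
proof (induction k)
  case 0
  then show ?case using C.zeta_0[of "(\<zero>\<^bsub>R\<^esub>, b)"] assms by (simp add: C_simps)
next
  case (Suc k)
  have b: "(\<zero>\<^bsub>R\<^esub>, b) \<in> carrier C" using assms by (simp add: C_simps)
  have cl: "fst (zeta C m (\<zero>\<^bsub>R\<^esub>, b)) \<in> carrier R" for m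
    using C.zeta_closed[OF b, of m] by (auto simp: C_simps)
  have "[Suc k] \<cdot>\<^bsub>R\<^esub> fst (zeta C (Suc k) (\<zero>\<^bsub>R\<^esub>, b)) \<oplus>\<^bsub>R\<^esub> [k] \<cdot>\<^bsub>R\<^esub> fst (zeta C k (\<zero>\<^bsub>R\<^esub>, b)) = \<zero>\<^bsub>R\<^esub>"
    using arg_cong[OF C.zeta_mult[OF b, of k], of fst] cl[of k]
    by (simp add: C_simps C_nat_mult del: R.add.nat_pow_Suc C.add.nat_pow_Suc)
  moreover have "[k] \<cdot>\<^bsub>R\<^esub> fst (zeta C k (\<zero>\<^bsub>R\<^esub>, b)) = \<zero>\<^bsub>R\<^esub>"
    by (cases "k = 0") (use Suc in simp_all)
  ultimately have "[Suc k] \<cdot>\<^bsub>R\<^esub> fst (zeta C (Suc k) (\<zero>\<^bsub>R\<^esub>, b)) = \<zero>\<^bsub>R\<^esub>"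
    using cl by (simp del: R.add.nat_pow_Suc)
  then show ?case using B.torsion_free[OF zero_less_Suc cl] by (simp del: R.add.nat_pow_Suc)
qed

text \<open>
  The product of zeta values attached to the tuple \<open>J\<close>, as an element of the external direct sum of
  \<open>R\<close> and \<open>G 1\<close>. Only the values of \<open>a\<close> and \<open>J\<close> on \<open>{..<n}\<close> matter.
\<close>

definition zeta_prod :: "nat \<Rightarrow> (nat \<Rightarrow> 'a) \<Rightarrow> (nat \<Rightarrow> nat) \<Rightarrow> 'r \<times> 'a"
  where "zeta_prod n a J = (\<Otimes>\<^bsub>C\<^esub>i\<in>{..<n}. zeta C (J i) (\<zero>\<^bsub>R\<^esub>, a i))"

text \<open>
  The component of that product in \<open>G 1\<close>. It agrees with \<open>zeta_tuple\<close> for \<open>J \<noteq> 0\<close>, and vanishes for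
  \<open>J = 0\<close>, where \<open>zeta_tuple\<close> is one.
\<close>

definition zeta_part :: "nat \<Rightarrow> (nat \<Rightarrow> 'a) \<Rightarrow> (nat \<Rightarrow> nat) \<Rightarrow> 'a"
  where "zeta_part n a J = snd (zeta_prod n a J)"

text \<open>
  The tuples below \<open>I\<close>, extensional outside \<open>{..<n}\<close>. Each stands for the splitting of \<open>I\<close> into \<open>J\<close>
  and \<open>I - J\<close>.
\<close>

definition box :: "nat \<Rightarrow> (nat \<Rightarrow> nat) \<Rightarrow> (nat \<Rightarrow> nat) set"
  where "box n I = (\<Pi>\<^sub>E i\<in>{..<n}. {..I i})"

text \<open>
  The image of the reduced coproduct of the product of zeta values, that is, the sum of the products
  \<open>z\<^sub>J \<union> z\<^sub>K\<close> over all \<open>J + K = I\<close>. The terms with \<open>J = 0\<close> or \<open>K = 0\<close> may be included, as they vanish.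
\<close>

definition coproduct :: "nat \<Rightarrow> (nat \<Rightarrow> 'a) \<Rightarrow> (nat \<Rightarrow> nat) \<Rightarrow> 'a"
  where "coproduct n a I =
    (\<Oplus>\<^bsub>A\<^esub>J\<in>box n I. zeta_part n a J \<otimes>\<^bsub>A\<^esub> zeta_part n a (\<lambda>i. I i - J i))"

lemma finite_box: "finite (box n I)"
  unfolding box_def by (intro finite_PiE) auto

lemma box_iff: "J \<in> box n I \<longleftrightarrow> J \<in> extensional {..<n} \<and> (\<forall>i<n. J i \<le> I i)"
  unfolding box_def PiE_iff by auto

lemma fst_finprod_C:
  assumes "finite S" "\<And>i. i \<in> S \<Longrightarrow> f i \<in> carrier C"
  shows "fst (\<Otimes>\<^bsub>C\<^esub>i\<in>S. f i) = (\<Otimes>\<^bsub>R\<^esub>i\<in>S. fst (f i))"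
  using assms
proof (induction S rule: finite_induct)
  case (insert x F)
  moreover have "f \<in> F \<rightarrow> carrier C" "f x \<in> carrier C" using insert.prems by auto
  moreover have "(\<lambda>i. fst (f i)) \<in> F \<rightarrow> carrier R" "fst (f x) \<in> carrier R"
    using insert.prems by (auto simp: C_simps(1) mem_Times_iff)
  ultimately show ?case by (simp add: C.finprod_insert R.finprod_insert C_simps(6))
qed (simp add: C_simps)

context
  fixes n :: nat and a :: "nat \<Rightarrow> 'a"
  assumes grade_a: "\<And>i. i < n \<Longrightarrow> a i \<in> G 1"
begin

lemma a_C: "i < n \<Longrightarrow> (\<zero>\<^bsub>R\<^esub>, a i) \<in> carrier C"
  using grade_a by (simp add: C_simps)

lemma zeta_prod_cong: "(\<And>i. i < n \<Longrightarrow> J i = K i) \<Longrightarrow> zeta_prod n a J = zeta_prod n a K"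
  unfolding zeta_prod_def by (intro C.finprod_cong') (auto intro!: C.zeta_closed a_C)

lemma zeta_prod_closed: "zeta_prod n a J \<in> carrier C"
  unfolding zeta_prod_def using a_C by (intro C.finprod_closed) (auto intro!: C.zeta_closed)

lemma zeta_part_grade: "zeta_part n a J \<in> G 1"
  using zeta_prod_closed[of J] unfolding zeta_part_def by (auto simp: C_simps)

lemma zeta_part_carrier: "zeta_part n a J \<in> carrier A"
  using zeta_part_grade by (rule grade_carrier)

lemma zeta_part_cong: "(\<And>i. i < n \<Longrightarrow> J i = K i) \<Longrightarrow> zeta_part n a J = zeta_part n a K"
  unfolding zeta_part_def using zeta_prod_cong by metis

lemma fst_zeta_prod: "fst (zeta_prod n a J) = (if \<forall>i<n. J i = 0 then \<one>\<^bsub>R\<^esub> else \<zero>\<^bsub>R\<^esub>)"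
proof -
  have "fst (zeta_prod n a J) = (\<Otimes>\<^bsub>R\<^esub>i\<in>{..<n}. fst (zeta C (J i) (\<zero>\<^bsub>R\<^esub>, a i)))"
    unfolding zeta_prod_def by (intro fst_finprod_C) (auto intro!: C.zeta_closed a_C)
  also have "\<dots> = (\<Otimes>\<^bsub>R\<^esub>i\<in>{..<n}. if J i = 0 then \<one>\<^bsub>R\<^esub> else \<zero>\<^bsub>R\<^esub>)"
    by (intro R.finprod_cong') (auto simp: fst_zeta[OF grade_a])
  also have "\<dots> = (if \<forall>i<n. J i = 0 then \<one>\<^bsub>R\<^esub> else \<zero>\<^bsub>R\<^esub>)"
    by (induction n) (auto simp: lessThan_Suc less_Suc_eq)
  finally show ?thesis .
qed

lemma zeta_part_zero:
  assumes "\<And>i. i < n \<Longrightarrow> J i = 0"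
  shows "zeta_part n a J = \<zero>\<^bsub>A\<^esub>"
proof -
  have "zeta_prod n a J = \<one>\<^bsub>C\<^esub>"
    unfolding zeta_prod_def by (intro C.finprod_one_eqI) (use assms a_C C.zeta_0 in auto)
  then show ?thesis unfolding zeta_part_def by (simp add: C_simps)
qed

text \<open>The component in \<open>G 1\<close> of the recurrence for products of zeta values.\<close>

lemma zeta_part_mult:
  assumes j: "j < n"
  shows "fst (zeta_prod n a J) \<odot>\<^bsub>A\<^esub> a j \<oplus>\<^bsub>A\<^esub> cup1 (zeta_part n a J) (a j) =
    [Suc (J j)] \<cdot>\<^bsub>A\<^esub> zeta_part n a (J(j := Suc (J j))) \<oplus>\<^bsub>A\<^esub> [J j] \<cdot>\<^bsub>A\<^esub> zeta_part n a J"
proof -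
  have "zeta_prod n a J \<otimes>\<^bsub>C\<^esub> (\<zero>\<^bsub>R\<^esub>, a j) =
      [Suc (J j)] \<cdot>\<^bsub>C\<^esub> zeta_prod n a (J(j := Suc (J j))) \<oplus>\<^bsub>C\<^esub> [J j] \<cdot>\<^bsub>C\<^esub> zeta_prod n a J"
    unfolding zeta_prod_def
    using C.zeta_finprod_mult[of "{..<n}" j "\<lambda>i. (\<zero>\<^bsub>R\<^esub>, a i)" J] j a_C by simp
  from arg_cong[OF this, of snd] show ?thesis
    using zeta_part_carrier[of J] grade_carrier[OF grade_a[OF j]] grade_a[OF j]
      grade_carrier[OF cup1_closed[of 1 "zeta_part n a J" "a j"]] zeta_part_grade[of J]
    by (simp add: C_simps C_nat_mult zeta_part_def[symmetric] fst_zeta_prod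
        del: M.add.nat_pow_Suc C.add.nat_pow_Suc)
qed

lemma coproduct_D2: "coproduct n a I \<in> D2 R A G"
  unfolding coproduct_def by (intro D2_finsum D2_mult zeta_part_grade)

section \<open>The cup-one product of a coproduct with a degree-one element\<close>

text \<open>
  Both sums are indexed by the splittings of \<open>I\<close>. Raising entry \<open>j\<close> of the left or of the right part
  turns them into weighted sums over the splittings of \<open>I + e\<^sub>j\<close>. The splittings that are not reached
  have weight zero.
\<close>

lemma sum_shift_left:
  assumes j: "j < n"
  shows "(\<Oplus>\<^bsub>A\<^esub>J\<in>box n I. [Suc (J j)] \<cdot>\<^bsub>A\<^esub>
      (zeta_part n a (J(j := Suc (J j))) \<otimes>\<^bsub>A\<^esub> zeta_part n a (\<lambda>i. I i - J i))) =
    (\<Oplus>\<^bsub>A\<^esub>J\<in>box n (I(j := Suc (I j))). [J j] \<cdot>\<^bsub>A\<^esub>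
      (zeta_part n a J \<otimes>\<^bsub>A\<^esub> zeta_part n a (\<lambda>i. (I(j := Suc (I j))) i - J i)))"
proof -
  let ?f = "\<lambda>J. [J j] \<cdot>\<^bsub>A\<^esub> (zeta_part n a J \<otimes>\<^bsub>A\<^esub> zeta_part n a (\<lambda>i. (I(j := Suc (I j))) i - J i))"
  let ?s = "\<lambda>J::nat \<Rightarrow> nat. J(j := Suc (J j))"
  have f: "?f J \<in> carrier A" for J by (simp add: zeta_part_carrier)
  have inj: "inj_on ?s (box n I)"
  proof (rule inj_onI)
    fix J K assume "?s J = ?s K"
    then have "J i = K i" for i by (cases "i = j") (metis fun_upd_apply nat.inject)+
    then show "J = K" by auto
  qed
  have sub: "?s ` box n I \<subseteq> box n (?s I)"
    using j by (auto simp: box_iff extensional_def intro: le_SucI)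
  have rest: "?f J = \<zero>\<^bsub>A\<^esub>" if J: "J \<in> box n (?s I) - ?s ` box n I" for J
  proof -
    have "J j = 0"
    proof (rule ccontr)
      assume nz: "J j \<noteq> 0"
      have "J(j := J j - 1) \<in> box n I"
        unfolding box_iff
      proof (intro conjI allI impI)
        show "J(j := J j - 1) \<in> extensional {..<n}" using J j by (auto simp: box_iff extensional_def)
        fix i assume "i < n"
        then show "(J(j := J j - 1)) i \<le> I i"
          using J nz by (auto simp: box_iff split: if_splits dest!: spec[of _ i])
      qed
      moreover have "J = ?s (J(j := J j - 1))" using nz by auto
      ultimately show False using J by blast
    qed
    then show ?thesis by simp
  qed
  have "(\<Oplus>\<^bsub>A\<^esub>J\<in>box n (?s I). ?f J) = (\<Oplus>\<^bsub>A\<^esub>J\<in>?s ` box n I. ?f J)"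
    by (rule M.add.finprod_mono_neutral_cong_right) (use sub rest f finite_box in auto)
  also have "\<dots> = (\<Oplus>\<^bsub>A\<^esub>J\<in>box n I. ?f (?s J))"
    by (rule M.finsum_reindex) (use inj f in auto)
  also have "\<dots> = (\<Oplus>\<^bsub>A\<^esub>J\<in>box n I. [Suc (J j)] \<cdot>\<^bsub>A\<^esub>
      (zeta_part n a (?s J) \<otimes>\<^bsub>A\<^esub> zeta_part n a (\<lambda>i. I i - J i)))"
  proof (rule M.finsum_cong'[OF refl])
    fix J
    have "zeta_part n a (\<lambda>i. (?s I) i - (?s J) i) = zeta_part n a (\<lambda>i. I i - J i)"
      by (rule zeta_part_cong) auto
    then show "?f (?s J) = [Suc (J j)] \<cdot>\<^bsub>A\<^esub> (zeta_part n a (?s J) \<otimes>\<^bsub>A\<^esub> zeta_part n a (\<lambda>i. I i - J i))"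
      by (simp del: M.add.nat_pow_Suc)
  qed (auto simp: zeta_part_carrier)
  finally show ?thesis ..
qed

lemma sum_shift_right:
  assumes j: "j < n"
  shows "(\<Oplus>\<^bsub>A\<^esub>J\<in>box n I. [(Suc (I j - J j))] \<cdot>\<^bsub>A\<^esub>
      (zeta_part n a J \<otimes>\<^bsub>A\<^esub> zeta_part n a ((\<lambda>i. I i - J i)(j := Suc (I j - J j))))) =
    (\<Oplus>\<^bsub>A\<^esub>J\<in>box n (I(j := Suc (I j))). [(Suc (I j) - J j)] \<cdot>\<^bsub>A\<^esub>
      (zeta_part n a J \<otimes>\<^bsub>A\<^esub> zeta_part n a (\<lambda>i. (I(j := Suc (I j))) i - J i)))"
proof (rule M.add.finprod_mono_neutral_cong_left)
  show "box n I \<subseteq> box n (I(j := Suc (I j)))"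
    by (auto simp: box_iff) (meson le_SucI)
  show "[(Suc (I j) - J j)] \<cdot>\<^bsub>A\<^esub>
      (zeta_part n a J \<otimes>\<^bsub>A\<^esub> zeta_part n a (\<lambda>i. (I(j := Suc (I j))) i - J i)) = \<zero>\<^bsub>A\<^esub>"
    if "J \<in> box n (I(j := Suc (I j))) - box n I" for J
  proof -
    have "J j = Suc (I j)"
      using that by (auto simp: box_iff le_Suc_eq split: if_splits)
    then show ?thesis by simp
  qed
  show "[(Suc (I j - J j))] \<cdot>\<^bsub>A\<^esub>
      (zeta_part n a J \<otimes>\<^bsub>A\<^esub> zeta_part n a ((\<lambda>i. I i - J i)(j := Suc (I j - J j)))) =
    [(Suc (I j) - J j)] \<cdot>\<^bsub>A\<^esub>
      (zeta_part n a J \<otimes>\<^bsub>A\<^esub> zeta_part n a (\<lambda>i. (I(j := Suc (I j))) i - J i))"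
    if "J \<in> box n I" for J
  proof -
    have le: "J j \<le> I j" using that j by (simp add: box_iff)
    have "zeta_part n a ((\<lambda>i. I i - J i)(j := Suc (I j - J j))) =
        zeta_part n a (\<lambda>i. (I(j := Suc (I j))) i - J i)"
      by (rule zeta_part_cong) (use le in auto)
    then show ?thesis using le by (simp add: Suc_diff_le del: M.add.nat_pow_Suc)
  qed
qed (auto simp: finite_box zeta_part_carrier)

text \<open>The component in \<open>R\<close> singles out one splitting: the one whose right, or left, part is zero.\<close>

lemma sum_counit_right:
  assumes x: "x \<in> G 1"
  shows "(\<Oplus>\<^bsub>A\<^esub>J\<in>box n I. zeta_part n a J \<otimes>\<^bsub>A\<^esub> (fst (zeta_prod n a (\<lambda>i. I i - J i)) \<odot>\<^bsub>A\<^esub> x)) =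
    zeta_part n a I \<otimes>\<^bsub>A\<^esub> x"
proof -
  let ?J = "restrict I {..<n}"
  have mem: "?J \<in> box n I" by (auto simp: box_iff)
  have xc: "x \<in> carrier A" using x by (rule grade_carrier)
  have eq: "zeta_part n a ?J = zeta_part n a I" by (rule zeta_part_cong) auto
  have "(\<Oplus>\<^bsub>A\<^esub>J\<in>box n I. zeta_part n a J \<otimes>\<^bsub>A\<^esub> (fst (zeta_prod n a (\<lambda>i. I i - J i)) \<odot>\<^bsub>A\<^esub> x)) =
      (\<Oplus>\<^bsub>A\<^esub>J\<in>box n I. if ?J = J then zeta_part n a J \<otimes>\<^bsub>A\<^esub> x else \<zero>\<^bsub>A\<^esub>)"
  proof (rule M.finsum_cong'[OF refl])
    fix J assume J: "J \<in> box n I"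
    have "(\<forall>i<n. I i - J i = 0) \<longleftrightarrow> ?J = J"
    proof
      assume "\<forall>i<n. I i - J i = 0"
      then show "?J = J"
        using J by (intro extensionalityI[of _ "{..<n}"]) (auto simp: box_iff intro: le_antisym)
    next
      assume "?J = J"
      then show "\<forall>i<n. I i - J i = 0" by (metis diff_self_eq_0 lessThan_iff restrict_apply')
    qed
    then show "zeta_part n a J \<otimes>\<^bsub>A\<^esub> (fst (zeta_prod n a (\<lambda>i. I i - J i)) \<odot>\<^bsub>A\<^esub> x) =
        (if ?J = J then zeta_part n a J \<otimes>\<^bsub>A\<^esub> x else \<zero>\<^bsub>A\<^esub>)"
      by (simp add: fst_zeta_prod xc zeta_part_carrier)
  qed (auto simp: zeta_part_carrier xc)
  also have "\<dots> = zeta_part n a ?J \<otimes>\<^bsub>A\<^esub> x"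
    by (rule M.finsum_singleton[OF mem finite_box]) (auto simp: zeta_part_carrier xc)
  finally show ?thesis unfolding eq .
qed

lemma sum_counit_left:
  assumes x: "x \<in> G 1"
  shows "(\<Oplus>\<^bsub>A\<^esub>J\<in>box n I. (fst (zeta_prod n a J) \<odot>\<^bsub>A\<^esub> x) \<otimes>\<^bsub>A\<^esub> zeta_part n a (\<lambda>i. I i - J i)) =
    x \<otimes>\<^bsub>A\<^esub> zeta_part n a I"
proof -
  let ?J = "restrict (\<lambda>_. 0) {..<n} :: nat \<Rightarrow> nat"
  have mem: "?J \<in> box n I" by (auto simp: box_iff)
  have xc: "x \<in> carrier A" using x by (rule grade_carrier)
  have eq: "zeta_part n a (\<lambda>i. I i - ?J i) = zeta_part n a I" by (rule zeta_part_cong) auto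
  have "(\<Oplus>\<^bsub>A\<^esub>J\<in>box n I. (fst (zeta_prod n a J) \<odot>\<^bsub>A\<^esub> x) \<otimes>\<^bsub>A\<^esub> zeta_part n a (\<lambda>i. I i - J i)) =
      (\<Oplus>\<^bsub>A\<^esub>J\<in>box n I. if ?J = J then x \<otimes>\<^bsub>A\<^esub> zeta_part n a (\<lambda>i. I i - J i) else \<zero>\<^bsub>A\<^esub>)"
  proof (rule M.finsum_cong'[OF refl])
    fix J assume J: "J \<in> box n I"
    have "(\<forall>i<n. J i = 0) \<longleftrightarrow> ?J = J"
    proof
      assume "\<forall>i<n. J i = 0"
      then show "?J = J"
        using J by (intro extensionalityI[of _ "{..<n}"]) (auto simp: box_iff)
    next
      assume "?J = J"
      then show "\<forall>i<n. J i = 0" by (metis lessThan_iff restrict_apply')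
    qed
    then show "(fst (zeta_prod n a J) \<odot>\<^bsub>A\<^esub> x) \<otimes>\<^bsub>A\<^esub> zeta_part n a (\<lambda>i. I i - J i) =
        (if ?J = J then x \<otimes>\<^bsub>A\<^esub> zeta_part n a (\<lambda>i. I i - J i) else \<zero>\<^bsub>A\<^esub>)"
      by (simp add: fst_zeta_prod xc zeta_part_carrier)
  qed (auto simp: zeta_part_carrier xc)
  also have "\<dots> = x \<otimes>\<^bsub>A\<^esub> zeta_part n a (\<lambda>i. I i - ?J i)"
    by (rule M.finsum_singleton[OF mem finite_box]) (auto simp: zeta_part_carrier xc)
  finally show ?thesis unfolding eq .
qed

text \<open>
  The identity holds for arbitrary degree-one elements \<open>a i\<close>: it results from the Hirsch identity and
  the recurrence for the zeta values, without the differential.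
\<close>

lemma coproduct_cup1:
  assumes j: "j < n"
  shows "cup1 (coproduct n a I) (a j) \<oplus>\<^bsub>A\<^esub>
      (zeta_part n a I \<otimes>\<^bsub>A\<^esub> a j \<oplus>\<^bsub>A\<^esub> a j \<otimes>\<^bsub>A\<^esub> zeta_part n a I) =
    [I j] \<cdot>\<^bsub>A\<^esub> coproduct n a I \<oplus>\<^bsub>A\<^esub> [Suc (I j)] \<cdot>\<^bsub>A\<^esub> coproduct n a (I(j := Suc (I j)))"
proof -
  let ?z = "zeta_part n a"
  let ?I' = "I(j := Suc (I j))"
  let ?e = "\<lambda>J. fst (zeta_prod n a J) \<odot>\<^bsub>A\<^esub> a j"
  let ?K = "\<lambda>J i. I i - J i"
  let ?f = "\<lambda>J. ?z J \<otimes>\<^bsub>A\<^esub> ?z (?K J)"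
  let ?f' = "\<lambda>J. ?z J \<otimes>\<^bsub>A\<^esub> ?z (\<lambda>i. ?I' i - J i)"
  let ?l = "\<lambda>J. [Suc (J j)] \<cdot>\<^bsub>A\<^esub> (?z (J(j := Suc (J j))) \<otimes>\<^bsub>A\<^esub> ?z (?K J))"
  let ?r = "\<lambda>J. [(Suc (I j - J j))] \<cdot>\<^bsub>A\<^esub> (?z J \<otimes>\<^bsub>A\<^esub> ?z ((?K J)(j := Suc (I j - J j))))"
  note [simp del] = M.add.nat_pow_Suc
  have aj: "a j \<in> G 1" and ajc [simp]: "a j \<in> carrier A" using grade_a[OF j] grade_carrier by auto
  note zg = zeta_part_grade
  have zc [simp]: "?z J \<in> carrier A" for J using zg by (rule grade_carrier)
  have ec [simp]: "?e J \<in> carrier A" for J by (simp add: fst_zeta_prod)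
  have cz [simp]: "cup1 (?z J) (a j) \<in> carrier A" for J
    using cup1_closed[of 1, OF _ zg aj] grade_carrier by blast
  have fg: "?f J \<in> G 2" for J using D2_grade[OF D2_mult[OF zg zg]] .
  have cf [simp]: "cup1 (?f J) (a j) \<in> carrier A" for J
    using cup1_closed[of 2, OF _ fg aj] grade_carrier by blast
  have summand: "cup1 (?f J) (a j) \<oplus>\<^bsub>A\<^esub> (?z J \<otimes>\<^bsub>A\<^esub> ?e (?K J) \<oplus>\<^bsub>A\<^esub> ?e J \<otimes>\<^bsub>A\<^esub> ?z (?K J)) =
      [I j] \<cdot>\<^bsub>A\<^esub> ?f J \<oplus>\<^bsub>A\<^esub> (?l J \<oplus>\<^bsub>A\<^esub> ?r J)" if J: "J \<in> box n I" for J
  proof -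
    have le: "J j \<le> I j" using J j by (simp add: box_iff)
    have "cup1 (?f J) (a j) \<oplus>\<^bsub>A\<^esub> (?z J \<otimes>\<^bsub>A\<^esub> ?e (?K J) \<oplus>\<^bsub>A\<^esub> ?e J \<otimes>\<^bsub>A\<^esub> ?z (?K J)) =
        ?z J \<otimes>\<^bsub>A\<^esub> (?e (?K J) \<oplus>\<^bsub>A\<^esub> cup1 (?z (?K J)) (a j)) \<oplus>\<^bsub>A\<^esub>
        (?e J \<oplus>\<^bsub>A\<^esub> cup1 (?z J) (a j)) \<otimes>\<^bsub>A\<^esub> ?z (?K J)"
      by (simp add: cup1_Hirsch[OF zg zg aj] A.l_distr A.r_distr M.add.m_ac)
    also have "\<dots> =
        ?z J \<otimes>\<^bsub>A\<^esub> ([(Suc (I j - J j))] \<cdot>\<^bsub>A\<^esub> ?z ((?K J)(j := Suc (I j - J j))) \<oplus>\<^bsub>A\<^esub>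
          [(I j - J j)] \<cdot>\<^bsub>A\<^esub> ?z (?K J)) \<oplus>\<^bsub>A\<^esub>
        ([Suc (J j)] \<cdot>\<^bsub>A\<^esub> ?z (J(j := Suc (J j))) \<oplus>\<^bsub>A\<^esub> [J j] \<cdot>\<^bsub>A\<^esub> ?z J) \<otimes>\<^bsub>A\<^esub> ?z (?K J)"
      using zeta_part_mult[OF j] by simp
    also have "\<dots> = (?r J \<oplus>\<^bsub>A\<^esub> [(I j - J j)] \<cdot>\<^bsub>A\<^esub> ?f J) \<oplus>\<^bsub>A\<^esub> (?l J \<oplus>\<^bsub>A\<^esub> [J j] \<cdot>\<^bsub>A\<^esub> ?f J)"
      by (simp add: A.l_distr A.r_distr A.add_pow_ldistr A.add_pow_rdistr)
    also have "\<dots> = ([J j] \<cdot>\<^bsub>A\<^esub> ?f J \<oplus>\<^bsub>A\<^esub> [(I j - J j)] \<cdot>\<^bsub>A\<^esub> ?f J) \<oplus>\<^bsub>A\<^esub> (?l J \<oplus>\<^bsub>A\<^esub> ?r J)"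
      by (simp add: M.add.m_ac)
    also have "[J j] \<cdot>\<^bsub>A\<^esub> ?f J \<oplus>\<^bsub>A\<^esub> [(I j - J j)] \<cdot>\<^bsub>A\<^esub> ?f J = [I j] \<cdot>\<^bsub>A\<^esub> ?f J"
      using le by (simp add: M.add.nat_pow_mult)
    finally show ?thesis .
  qed
  have "cup1 (coproduct n a I) (a j) \<oplus>\<^bsub>A\<^esub> (?z I \<otimes>\<^bsub>A\<^esub> a j \<oplus>\<^bsub>A\<^esub> a j \<otimes>\<^bsub>A\<^esub> ?z I) =
      (\<Oplus>\<^bsub>A\<^esub>J\<in>box n I. cup1 (?f J) (a j)) \<oplus>\<^bsub>A\<^esub>
      ((\<Oplus>\<^bsub>A\<^esub>J\<in>box n I. ?z J \<otimes>\<^bsub>A\<^esub> ?e (?K J)) \<oplus>\<^bsub>A\<^esub> (\<Oplus>\<^bsub>A\<^esub>J\<in>box n I. ?e J \<otimes>\<^bsub>A\<^esub> ?z (?K J)))"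
    unfolding coproduct_def sum_counit_left[OF aj] sum_counit_right[OF aj]
    using cup1_finsum[of 2 "a j" "box n I" ?f] aj fg by simp
  also have "\<dots> = (\<Oplus>\<^bsub>A\<^esub>J\<in>box n I. cup1 (?f J) (a j) \<oplus>\<^bsub>A\<^esub>
      (?z J \<otimes>\<^bsub>A\<^esub> ?e (?K J) \<oplus>\<^bsub>A\<^esub> ?e J \<otimes>\<^bsub>A\<^esub> ?z (?K J)))"
    by (simp add: M.finsum_addf)
  also have "\<dots> = (\<Oplus>\<^bsub>A\<^esub>J\<in>box n I. [I j] \<cdot>\<^bsub>A\<^esub> ?f J \<oplus>\<^bsub>A\<^esub> (?l J \<oplus>\<^bsub>A\<^esub> ?r J))"
    by (rule M.finsum_cong'[OF refl _ summand]) auto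
  also have "\<dots> = (\<Oplus>\<^bsub>A\<^esub>J\<in>box n I. [I j] \<cdot>\<^bsub>A\<^esub> ?f J) \<oplus>\<^bsub>A\<^esub>
      ((\<Oplus>\<^bsub>A\<^esub>J\<in>box n I. ?l J) \<oplus>\<^bsub>A\<^esub> (\<Oplus>\<^bsub>A\<^esub>J\<in>box n I. ?r J))"
    by (simp add: M.finsum_addf)
  also have "(\<Oplus>\<^bsub>A\<^esub>J\<in>box n I. [I j] \<cdot>\<^bsub>A\<^esub> ?f J) = [I j] \<cdot>\<^bsub>A\<^esub> coproduct n a I"
    unfolding coproduct_def by (rule M.finsum_nat_mult) simp
  also have "(\<Oplus>\<^bsub>A\<^esub>J\<in>box n I. ?l J) \<oplus>\<^bsub>A\<^esub> (\<Oplus>\<^bsub>A\<^esub>J\<in>box n I. ?r J) =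
      (\<Oplus>\<^bsub>A\<^esub>J\<in>box n ?I'. [J j] \<cdot>\<^bsub>A\<^esub> ?f' J \<oplus>\<^bsub>A\<^esub> [(Suc (I j) - J j)] \<cdot>\<^bsub>A\<^esub> ?f' J)"
    unfolding sum_shift_left[OF j] sum_shift_right[OF j] by (simp add: M.finsum_addf)
  \<comment> \<open>The weights \<open>J j\<close> and \<open>Suc (I j) - J j\<close> of a splitting add up to a constant.\<close>
  also have "\<dots> = (\<Oplus>\<^bsub>A\<^esub>J\<in>box n ?I'. [Suc (I j)] \<cdot>\<^bsub>A\<^esub> ?f' J)"
  proof (rule M.finsum_cong'[OF refl])
    fix J assume "J \<in> box n ?I'"
    then have "J j \<le> Suc (I j)" using j by (auto simp: box_iff dest: spec[of _ j])
    then show "[J j] \<cdot>\<^bsub>A\<^esub> ?f' J \<oplus>\<^bsub>A\<^esub> [(Suc (I j) - J j)] \<cdot>\<^bsub>A\<^esub> ?f' J = [Suc (I j)] \<cdot>\<^bsub>A\<^esub> ?f' J"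
      by (simp only: M.add.nat_pow_mult[OF A.m_closed[OF zc zc]] le_add_diff_inverse)
  qed auto
  also have "\<dots> = [Suc (I j)] \<cdot>\<^bsub>A\<^esub> coproduct n a ?I'"
    unfolding coproduct_def by (rule M.finsum_nat_mult) simp
  finally show ?thesis .
qed

section \<open>The coproduct as a sum over nonzero splittings\<close>

lemma zeta_tuple_eq: "zeta_tuple R A G cup1 n J a = cup_one_incl A (zeta_prod n a J)"
  unfolding zeta_tuple_def zeta_prod_def ..

lemma zeta_tuple_eq_zeta_part:
  assumes "i < n" "J i \<noteq> 0"
  shows "zeta_tuple R A G cup1 n J a = zeta_part n a J"
proof -
  have "fst (zeta_prod n a J) = \<zero>\<^bsub>R\<^esub>" using assms fst_zeta_prod by auto
  then show ?thesis
    unfolding zeta_tuple_eq zeta_part_def cup_one_incl_def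
    using zeta_part_carrier[of J] by (simp add: case_prod_beta zeta_part_def)
qed

text \<open>
  Splittings with a zero tuple contribute nothing to the coproduct, as \<open>zeta_part\<close> vanishes there.
  On the others \<open>zeta_part\<close> and \<open>zeta_tuple\<close> agree.
\<close>

lemma coproduct_eq_sum_nonzero_splittings:
  "coproduct n a I = finsum A
    (\<lambda>(J, K). zeta_tuple R A G cup1 n J a \<otimes>\<^bsub>A\<^esub> zeta_tuple R A G cup1 n K a)
    (nonzero_splittings n I)"
proof -
  let ?z = "zeta_part n a"
  let ?f = "\<lambda>J. ?z J \<otimes>\<^bsub>A\<^esub> ?z (\<lambda>i. I i - J i)"
  let ?g = "\<lambda>(J, K). zeta_tuple R A G cup1 n J a \<otimes>\<^bsub>A\<^esub> zeta_tuple R A G cup1 n K a"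
  let ?h = "\<lambda>J. (J, restrict (\<lambda>i. I i - J i) {..<n})"
  let ?S = "{J \<in> box n I. (\<exists>i<n. J i \<noteq> 0) \<and> (\<exists>i<n. I i - J i \<noteq> 0)}"
  have f: "?f J \<in> carrier A" for J by (simp add: zeta_part_carrier)
  have g: "?g (?h J) = ?f J" if J: "J \<in> ?S" for J
  proof -
    have K: "?z (restrict (\<lambda>i. I i - J i) {..<n}) = ?z (\<lambda>i. I i - J i)"
      by (rule zeta_part_cong) simp
    obtain i where i: "i < n" "J i \<noteq> 0" using J by auto
    obtain k where k: "k < n" "restrict (\<lambda>i. I i - J i) {..<n} k \<noteq> 0"
      using J by auto
    show ?thesis
      by (simp only: prod.case zeta_tuple_eq_zeta_part[of i J, OF i]
          zeta_tuple_eq_zeta_part[of k "restrict (\<lambda>i. I i - J i) {..<n}", OF k] K)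
  qed
  have image: "?h ` ?S = nonzero_splittings n I"
  proof (intro equalityI subsetI)
    fix p assume "p \<in> ?h ` ?S"
    then show "p \<in> nonzero_splittings n I"
      by (auto simp: nonzero_splittings_def box_iff PiE_iff)
  next
    fix p assume "p \<in> nonzero_splittings n I"
    then obtain J K where p: "p = (J, K)" and JK: "J \<in> extensional {..<n}" "K \<in> extensional {..<n}"
        "\<And>i. i < n \<Longrightarrow> J i + K i = I i" "\<exists>i<n. J i \<noteq> 0" "\<exists>i<n. K i \<noteq> 0"
      by (auto simp: nonzero_splittings_def PiE_iff)
    have diff: "I i - J i = K i" and le: "J i \<le> I i" if "i < n" for i
      using JK(3)[OF that] by simp_all
    have "K = restrict (\<lambda>i. I i - J i) {..<n}"
      using JK(2) diff by (intro extensionalityI[of _ "{..<n}"]) auto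
    moreover have "\<exists>i<n. I i - J i \<noteq> 0" using JK(5) diff by metis
    then have "J \<in> ?S" using JK(1,4) le by (simp add: box_iff)
    ultimately show "p \<in> ?h ` ?S" unfolding p by blast
  qed
  have inj: "inj_on ?h ?S" by (rule inj_onI) simp
  have "coproduct n a I = (\<Oplus>\<^bsub>A\<^esub>J\<in>?S. ?f J)"
    unfolding coproduct_def
  proof (rule M.add.finprod_mono_neutral_cong_right)
    fix J assume "J \<in> box n I - ?S"
    then consider "\<And>i. i < n \<Longrightarrow> J i = 0" | "\<And>i. i < n \<Longrightarrow> I i - J i = 0" by blast
    then show "?f J = \<zero>\<^bsub>A\<^esub>"
    proof cases
      case 1
      from zeta_part_zero[of J, OF this] show ?thesis by (simp add: zeta_part_carrier)
    next
      case 2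
      from zeta_part_zero[of "\<lambda>i. I i - J i", OF this] show ?thesis by (simp add: zeta_part_carrier)
    qed
  qed (use f finite_box in auto)
  also have "\<dots> = (\<Oplus>\<^bsub>A\<^esub>J\<in>?S. ?g (?h J))"
    by (rule M.finsum_cong'[OF refl]) (use f g in auto)
  also have "\<dots> = finsum A ?g (?h ` ?S)"
  proof (rule M.finsum_reindex[symmetric])
    show "?g \<in> ?h ` ?S \<rightarrow> carrier A"
    proof
      fix p assume "p \<in> ?h ` ?S"
      then obtain J where "J \<in> ?S" "p = ?h J" by blast
      then show "?g p \<in> carrier A" using g[of J] f[of J] by simp
    qed
  qed (rule inj)
  finally show ?thesis unfolding image .
qed

section \<open>The differential of a product of zeta values\<close>

context
  assumes diff_a: "\<And>i. i < n \<Longrightarrow> d (a i) = \<zero>\<^bsub>A\<^esub>"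
    and torsion_free_G2: "torsion_free_on A (G 2)"
begin

lemma diff_zeta_part_step:
  assumes j: "j < n" and IH: "d (zeta_part n a I) = \<ominus>\<^bsub>A\<^esub> coproduct n a I"
  shows "d (zeta_part n a (I(j := Suc (I j)))) = \<ominus>\<^bsub>A\<^esub> coproduct n a (I(j := Suc (I j)))"
proof -
  let ?I' = "I(j := Suc (I j))"
  let ?z = "zeta_part n a I" and ?z' = "zeta_part n a ?I'"
  let ?T = "coproduct n a I" and ?T' = "coproduct n a ?I'"
  let ?e = "fst (zeta_prod n a I) \<odot>\<^bsub>A\<^esub> a j"
  note [simp del] = M.add.nat_pow_Suc
  have aj: "a j \<in> G 1" and ajc [simp]: "a j \<in> carrier A" using grade_a[OF j] grade_carrier by auto
  note zg = zeta_part_grade and TD = coproduct_D2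
  have zc [simp]: "zeta_part n a J \<in> carrier A" for J using zg by (rule grade_carrier)
  have Tc [simp]: "coproduct n a J \<in> carrier A" for J using grade_carrier[OF D2_grade[OF TD]] .
  have cz: "cup1 ?z (a j) \<in> G 1"
    using cup1_closed[of 1, OF _ zg aj] by blast
  have cT [simp]: "cup1 ?T (a j) \<in> carrier A"
    using cup1_closed[of 2, OF _ D2_grade[OF TD] aj] grade_carrier by blast
  have dz': "d ?z' \<in> G 2" using diff_grade[OF zg] by (simp add: numeral_2_eq_2)
  have dz'c [simp]: "d ?z' \<in> carrier A" using dz' by (rule grade_carrier)
  have e: "?e \<in> G 1" "d ?e = \<zero>\<^bsub>A\<^esub>"
    using aj grade_zero diff_a[OF j] by (auto simp: fst_zeta_prod diff_zero)
  have "d (cup1 ?z (a j)) = \<ominus>\<^bsub>A\<^esub> (?z \<otimes>\<^bsub>A\<^esub> a j) \<ominus>\<^bsub>A\<^esub> a j \<otimes>\<^bsub>A\<^esub> ?z \<oplus>\<^bsub>A\<^esub> cup1 (\<ominus>\<^bsub>A\<^esub> ?T) (a j)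
      \<oplus>\<^bsub>A\<^esub> cup1 \<zero>\<^bsub>A\<^esub> ?z \<ominus>\<^bsub>A\<^esub> circ (\<ominus>\<^bsub>A\<^esub> ?T) \<zero>\<^bsub>A\<^esub>"
    \<comment> \<open>The formula for \<open>d\<close> of a cup-one product applies because \<open>IH\<close> puts \<open>d ?z\<close> into \<open>D2\<close>.\<close>
    using diff_cup1[OF zg aj, of I] D2_minus[OF TD] D2_zero by (simp add: IH diff_a[OF j])
  also have "\<dots> = \<ominus>\<^bsub>A\<^esub> (?z \<otimes>\<^bsub>A\<^esub> a j) \<ominus>\<^bsub>A\<^esub> a j \<otimes>\<^bsub>A\<^esub> ?z \<ominus>\<^bsub>A\<^esub> cup1 ?T (a j)"
    using cup1_minus[of 2, OF _ D2_grade[OF TD] aj] cup1_zero[of 2, OF _ zg]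
      circ_zero_right[OF D2_minus[OF TD]] by (simp add: a_minus_def)
  also have "\<dots> = \<ominus>\<^bsub>A\<^esub> (cup1 ?T (a j) \<oplus>\<^bsub>A\<^esub> (?z \<otimes>\<^bsub>A\<^esub> a j \<oplus>\<^bsub>A\<^esub> a j \<otimes>\<^bsub>A\<^esub> ?z))"
    by (simp add: a_minus_def M.minus_add M.add.m_ac)
  finally have dcup: "d (cup1 ?z (a j)) = \<ominus>\<^bsub>A\<^esub> ([I j] \<cdot>\<^bsub>A\<^esub> ?T \<oplus>\<^bsub>A\<^esub> [Suc (I j)] \<cdot>\<^bsub>A\<^esub> ?T')"
    unfolding coproduct_cup1[OF j] .
  have "d (?e \<oplus>\<^bsub>A\<^esub> cup1 ?z (a j)) = d (cup1 ?z (a j))"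
    using diff_add[OF grade_carrier[OF e(1)] grade_carrier[OF cz]] e(2) by (simp add: dcup)
  moreover have "d (?e \<oplus>\<^bsub>A\<^esub> cup1 ?z (a j)) = [Suc (I j)] \<cdot>\<^bsub>A\<^esub> d ?z' \<oplus>\<^bsub>A\<^esub> [I j] \<cdot>\<^bsub>A\<^esub> (\<ominus>\<^bsub>A\<^esub> ?T)"
    unfolding zeta_part_mult[OF j]
    by (simp add: diff_add diff_nat_mult[OF zg] IH)
  ultimately have eq: "[Suc (I j)] \<cdot>\<^bsub>A\<^esub> d ?z' \<oplus>\<^bsub>A\<^esub> \<ominus>\<^bsub>A\<^esub> ([I j] \<cdot>\<^bsub>A\<^esub> ?T) =
      \<ominus>\<^bsub>A\<^esub> ([Suc (I j)] \<cdot>\<^bsub>A\<^esub> ?T') \<oplus>\<^bsub>A\<^esub> \<ominus>\<^bsub>A\<^esub> ([I j] \<cdot>\<^bsub>A\<^esub> ?T)"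
    by (simp add: dcup M.minus_add M.add.nat_pow_inv M.add.m_ac)
  then have eq': "[Suc (I j)] \<cdot>\<^bsub>A\<^esub> d ?z' = \<ominus>\<^bsub>A\<^esub> ([Suc (I j)] \<cdot>\<^bsub>A\<^esub> ?T')"
    by simp
  have "[Suc (I j)] \<cdot>\<^bsub>A\<^esub> (d ?z' \<oplus>\<^bsub>A\<^esub> ?T') = [Suc (I j)] \<cdot>\<^bsub>A\<^esub> d ?z' \<oplus>\<^bsub>A\<^esub> [Suc (I j)] \<cdot>\<^bsub>A\<^esub> ?T'"
    by (simp add: M.add.pow_mult_distrib M.a_comm)
  also have "\<dots> = \<zero>\<^bsub>A\<^esub>" unfolding eq' by (simp add: M.l_neg)
  finally have "d ?z' \<oplus>\<^bsub>A\<^esub> ?T' = \<zero>\<^bsub>A\<^esub>"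
    using torsion_free_G2 grade_add[OF dz' D2_grade[OF TD, of ?I']]
    unfolding torsion_free_on_def by blast
  then show ?thesis by (rule M.minus_equality[symmetric]) simp_all
qed

lemma diff_zeta_part: "d (zeta_part n a I) = \<ominus>\<^bsub>A\<^esub> coproduct n a I"
proof (induction "\<Sum>i<n. I i" arbitrary: I)
  case 0
  then have I: "I i = 0" if "i < n" for i using that by simp
  have "zeta_part n a J \<otimes>\<^bsub>A\<^esub> zeta_part n a (\<lambda>i. I i - J i) = \<zero>\<^bsub>A\<^esub>" for J
    using I zeta_part_zero[of "\<lambda>i. I i - J i"] zeta_part_carrier[of J]
    by simp
  then have "coproduct n a I = \<zero>\<^bsub>A\<^esub>" unfolding coproduct_def by simp
  then show ?case using zeta_part_zero[OF I] diff_zero by simp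
next
  case (Suc m)
  then obtain j where j: "j < n" "I j \<noteq> 0" by (metis lessThan_iff nat.distinct(1) sum.neutral)
  define I0 where "I0 = I(j := I j - 1)"
  have I: "I = I0(j := Suc (I0 j))" using j by (auto simp: I0_def)
  have "(\<Sum>i<n. I i) = I j + (\<Sum>i\<in>{..<n} - {j}. I i)" using j by (simp add: sum.remove)
  moreover have "(\<Sum>i<n. I0 i) = I0 j + (\<Sum>i\<in>{..<n} - {j}. I0 i)" using j by (simp add: sum.remove)
  moreover have "(\<Sum>i\<in>{..<n} - {j}. I0 i) = (\<Sum>i\<in>{..<n} - {j}. I i)"
    by (rule sum.cong) (auto simp: I0_def)
  ultimately have "m = (\<Sum>i<n. I0 i)" using Suc.hyps(2) j by (simp add: I0_def)
  from diff_zeta_part_step[OF j(1) Suc.hyps(1)[OF this]] show ?case unfolding I[symmetric] .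
qed

lemma diff_zeta_tuple:
  "d (zeta_tuple R A G cup1 n I a) =
    \<ominus>\<^bsub>A\<^esub> finsum A
      (\<lambda>(J, K). zeta_tuple R A G cup1 n J a \<otimes>\<^bsub>A\<^esub> zeta_tuple R A G cup1 n K a)
      (nonzero_splittings n I)"
proof -
  have "zeta_prod n a I = (fst (zeta_prod n a I), zeta_part n a I)"
    "fst (zeta_prod n a I) \<in> carrier R"
    using zeta_prod_closed[of I] by (auto simp: zeta_part_def C_simps(1))
  then have "d (zeta_tuple R A G cup1 n I a) = d (zeta_part n a I)"
    unfolding zeta_tuple_eq using diff_cup_one_incl[OF _ zeta_part_grade] by metis
  then show ?thesis
    using diff_zeta_part[of I] by (simp only: coproduct_eq_sum_nonzero_splittings)
qed

end

end

section \<open>Tuples of length one\<close>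

lemma zeta_tuple_one:
  assumes "b \<in> G 1"
  shows "zeta_tuple R A G cup1 1 J (\<lambda>_. b) = zeta1 R A G cup1 (J 0) b"
proof -
  have "zeta C k (\<zero>\<^bsub>R\<^esub>, b) \<in> carrier C" for k
    using assms by (intro C.zeta_closed) (simp add: C_simps)
  then show ?thesis unfolding zeta_tuple_def zeta1_def by (simp add: lessThan_Suc)
qed

lemma diff_zeta1:
  assumes b: "b \<in> G 1" "d b = \<zero>\<^bsub>A\<^esub>" and tf: "torsion_free_on A (G 2)"
  shows "d (zeta1 R A G cup1 k b) =
    \<ominus>\<^bsub>A\<^esub> (\<Oplus>\<^bsub>A\<^esub>l\<in>{1..<k}. zeta1 R A G cup1 l b \<otimes>\<^bsub>A\<^esub> zeta1 R A G cup1 (k - l) b)"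
proof -
  let ?t = "\<lambda>J. zeta_tuple R A G cup1 1 J (\<lambda>_. b)"
  let ?g = "\<lambda>(J, K). ?t J \<otimes>\<^bsub>A\<^esub> ?t K"
  let ?h = "\<lambda>l. (\<lambda>i\<in>{..<1::nat}. l, \<lambda>i\<in>{..<1::nat}. k - l)"
  have gh: "?g (?h l) = zeta1 R A G cup1 l b \<otimes>\<^bsub>A\<^esub> zeta1 R A G cup1 (k - l) b" for l
    by (simp only: prod.case zeta_tuple_one[OF b(1)]) simp
  have closed: "zeta1 R A G cup1 l b \<in> carrier A" for l
  proof -
    have "zeta C l (\<zero>\<^bsub>R\<^esub>, b) \<in> carrier C"
      using b by (intro C.zeta_closed) (simp add: C_simps)
    then show ?thesis
      using grade_carrier[of _ 1] unfolding zeta1_def cup_one_incl_def by (auto simp: C_simps(1))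
  qed
  have inj: "inj_on ?h {1..<k}"
    by (rule inj_onI) (metis Pair_inject lessThan_iff restrict_apply' zero_less_one)
  have image: "?h ` {1..<k} = nonzero_splittings 1 (\<lambda>_. k)"
  proof (intro equalityI subsetI)
    fix p assume "p \<in> ?h ` {1..<k}"
    then show "p \<in> nonzero_splittings 1 (\<lambda>_. k)"
      by (auto simp: nonzero_splittings_def PiE_iff)
  next
    fix p assume "p \<in> nonzero_splittings 1 (\<lambda>_. k)"
    then obtain J K where p: "p = (J, K)"
      and JK: "J \<in> extensional {..<1}" "K \<in> extensional {..<1}"
        "J 0 + K 0 = k" "J 0 \<noteq> 0" "K 0 \<noteq> 0"
      by (auto simp: nonzero_splittings_def PiE_iff)
    have "J = (\<lambda>i\<in>{..<1}. J 0)" "K = (\<lambda>i\<in>{..<1}. k - J 0)"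
      using JK by (auto intro!: extensionalityI[of _ "{..<1}"])
    then have "p = ?h (J 0)" unfolding p by simp
    moreover have "J 0 \<in> {1..<k}" using JK by auto
    ultimately show "p \<in> ?h ` {1..<k}" by blast
  qed
  have "d (zeta1 R A G cup1 k b) = d (?t (\<lambda>_. k))" by (simp only: zeta_tuple_one[OF b(1)])
  also have "\<dots> = \<ominus>\<^bsub>A\<^esub> finsum A ?g (?h ` {1..<k})"
    unfolding image by (rule diff_zeta_tuple) (use b tf in auto)
  also have "finsum A ?g (?h ` {1..<k}) = (\<Oplus>\<^bsub>A\<^esub>l\<in>{1..<k}. ?g (?h l))"
  proof (rule M.finsum_reindex[OF _ inj])
    show "?g \<in> ?h ` {1..<k} \<rightarrow> carrier A"
    proof
      fix p assume "p \<in> ?h ` {1..<k}"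
      then obtain l where "p = ?h l" by blast
      then show "?g p \<in> carrier A" using gh[of l] closed by simp
    qed
  qed
  finally show ?thesis unfolding gh .
qed

end

theorem theorem6p13:
  fixes R :: "('r, 'm) ring_scheme" and A :: "('r, 'a, 'n) module_scheme"
    and G :: "nat \<Rightarrow> 'a set" and d :: "'a \<Rightarrow> 'a" and cup1 circ :: "'a \<Rightarrow> 'a \<Rightarrow> 'a"
  assumes "binomial_cup_one_dga R A G d cup1 circ"
    and "torsion_free_on A (G 2)"
  shows
    "(\<forall>a\<in>Z1 A G d. \<forall>k.
        d (zeta1 R A G cup1 k a) =
          \<ominus>\<^bsub>A\<^esub> (\<Oplus>\<^bsub>A\<^esub>l\<in>{1..<k}. zeta1 R A G cup1 l a \<otimes>\<^bsub>A\<^esub> zeta1 R A G cup1 (k - l) a)) \<and>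
     (\<forall>n I a. (\<forall>i<n. a i \<in> Z1 A G d) \<longrightarrow>
        d (zeta_tuple R A G cup1 n I a) =
          \<ominus>\<^bsub>A\<^esub> finsum A
            (\<lambda>(J, K). zeta_tuple R A G cup1 n J a \<otimes>\<^bsub>A\<^esub> zeta_tuple R A G cup1 n K a)
            (nonzero_splittings n I))"
proof (intro conjI ballI allI impI)
  interpret binomial_cup_one_dga R A G d cup1 circ by (rule assms(1))
  show "d (zeta1 R A G cup1 k b) =
      \<ominus>\<^bsub>A\<^esub> (\<Oplus>\<^bsub>A\<^esub>l\<in>{1..<k}. zeta1 R A G cup1 l b \<otimes>\<^bsub>A\<^esub> zeta1 R A G cup1 (k - l) b)"
    if "b \<in> Z1 A G d" for b k
    using that assms(2) by (intro diff_zeta1) (auto simp: Z1_def)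
  show "d (zeta_tuple R A G cup1 n I a) =
      \<ominus>\<^bsub>A\<^esub> finsum A
        (\<lambda>(J, K). zeta_tuple R A G cup1 n J a \<otimes>\<^bsub>A\<^esub> zeta_tuple R A G cup1 n K a)
        (nonzero_splittings n I)"
    if "\<forall>i<n. a i \<in> Z1 A G d" for n I a
    using that assms(2) by (intro diff_zeta_tuple) (auto simp: Z1_def)
qed

end
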